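(* For $m\ge 3$ and $n\geq 1$, the chromatic polynomial of the signed book graph $B_1(m,n)=(B(m,n),\{uu_1^1\})$ is $\chi_{B_1(m,n)}(\lambda)=(\lambda-1)^m\gamma_m^{n-1}$, where $\gamma_m=\frac{(\lambda-1)^{m-1}-(-1)^{m-1}}{\lambda}$.
   Context: The book graph $B(m,n)$ has vertices $\{u,v\}\cup\{u_j^i:1\le i\le n,1\le j\le m-2\}$ and consists of the $n$ cycles $uu_1^i\cdots u_{m-2}^ivu$ sharing the edge $uv$. $(B(m,n),\{uu_1^1\})$ is the signed graph on $B(m,n)$ in which $uu_1^1$ is the only negative edge. For a signed graph with sign function $\sigma$, a proper coloring with colors $\{-k,\ldots,0,\ldots,k\}$ is a map $c$ with $c(x)\ne\sigma(e)c(y)$ for each edge $e=xy$; the chromatic polynomial is the polynomial whose value at $\lambda=2k+1$ counts proper colorings. *)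

theory Defs
  imports "HOL-Library.FuncSet" "HOL-Computational_Algebra.Polynomial"
begin

record 'a ugraph =
  verts :: "'a set"
  edges :: "'a set set"

record 'a sgraph = "'a ugraph" +
  esign :: "'a set \<Rightarrow> int"

locale signed_graph =
  fixes G :: "'a sgraph"
  assumes finite_verts: "finite (verts G)"
    and edges_wf: "e \<in> edges G \<Longrightarrow> e \<subseteq> verts G \<and> card e = 2"
    and esign_wf: "e \<in> edges G \<Longrightarrow> esign G e = 1 \<or> esign G e = -1"

text \<open>The signed graph on \<open>G\<close> whose set of negative edges is \<open>N\<close>.\<close>

definition with_negative_edges :: "'a ugraph \<Rightarrow> 'a set set \<Rightarrow> 'a sgraph" where
  "with_negative_edges G N =
     \<lparr>verts = verts G, edges = edges G, esign = (\<lambda>e. if e \<in> N then -1 else 1)\<rparr>"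

text \<open>Colorings are extensional functions (\<open>undefined\<close> off the vertex set), so that each
  coloring of the vertices is counted exactly once.\<close>

definition proper_colorings :: "'a sgraph \<Rightarrow> nat \<Rightarrow> ('a \<Rightarrow> int) set" where
  "proper_colorings G k =
     {c \<in> verts G \<rightarrow>\<^sub>E {- int k..int k}.
        \<forall>x y. {x, y} \<in> edges G \<longrightarrow> c x \<noteq> esign G {x, y} * c y}"

definition chromatic_poly :: "'a sgraph \<Rightarrow> int poly" where
  "chromatic_poly G =
     (THE p. \<forall>k::nat. poly p (2 * int k + 1) = int (card (proper_colorings G k)))"

lemma chromatic_poly_eqI:
  assumes "\<And>k::nat. poly p (2 * int k + 1) = int (card (proper_colorings G k))"
  shows "chromatic_poly G = p"
  unfolding chromatic_poly_def
proof (rule the_equality)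
  fix q :: "int poly"
  assume q: "\<forall>k::nat. poly q (2 * int k + 1) = int (card (proper_colorings G k))"
  have "range (\<lambda>k::nat. 2 * int k + 1) \<subseteq> {x. poly (q - p) x = 0}"
    using q assms by auto
  moreover have "infinite (range (\<lambda>k::nat. 2 * int k + 1))"
    by (rule range_inj_infinite) (simp add: inj_def)
  ultimately have "infinite {x. poly (q - p) x = 0}"
    by (rule infinite_super)
  then show "q = p"
    using poly_roots_finite[of "q - p"] by auto
qed (use assms in blast)

text \<open>\<open>Page i j\<close> is the vertex $u_j^i$, the \<open>j\<close>-th inner vertex of the \<open>i\<close>-th cycle.\<close>

datatype book_vertex = Spine_u | Spine_v | Page nat nat

definition book :: "nat \<Rightarrow> nat \<Rightarrow> book_vertex ugraph" where
  "book m n =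
     \<lparr>verts = {Spine_u, Spine_v} \<union> {Page i j |i j. 1 \<le> i \<and> i \<le> n \<and> 1 \<le> j \<and> j \<le> m - 2},
      edges = {{Spine_u, Spine_v}}
        \<union> {{Spine_u, Page i 1} |i. 1 \<le> i \<and> i \<le> n}
        \<union> {{Page i j, Page i (j + 1)} |i j. 1 \<le> i \<and> i \<le> n \<and> 1 \<le> j \<and> j + 1 \<le> m - 2}
        \<union> {{Page i (m - 2), Spine_v} |i. 1 \<le> i \<and> i \<le> n}\<rparr>"

definition signed_book :: "nat \<Rightarrow> nat \<Rightarrow> book_vertex sgraph" where
  "signed_book m n = with_negative_edges (book m n) {{Spine_u, Page 1 1}}"

lemma signed_graph_signed_book:
  assumes "m \<ge> 3"
  shows "signed_graph (signed_book m n)"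
proof
  have "{Page i j |i j. 1 \<le> i \<and> i \<le> n \<and> 1 \<le> j \<and> j \<le> m - 2}
      = (\<lambda>(i, j). Page i j) ` ({1..n} \<times> {1..m - 2})"
    by auto
  then show "finite (verts (signed_book m n))"
    by (simp add: signed_book_def with_negative_edges_def book_def)
next
  fix e
  assume "e \<in> edges (signed_book m n)"
  then show "e \<subseteq> verts (signed_book m n) \<and> card e = 2"
    using assms by (auto simp: signed_book_def with_negative_edges_def book_def)
next
  fix e
  show "esign (signed_book m n) e = 1 \<or> esign (signed_book m n) e = -1"
    by (simp add: signed_book_def with_negative_edges_def)
qed

text \<open>The variable $\lambda$ is \<open>[:0, 1:]\<close>; the division is exact.\<close>

definition book_gamma :: "nat \<Rightarrow> int poly" where
  "book_gamma m = (([:0, 1:] - 1) ^ (m - 1) - (-1) ^ (m - 1)) div [:0, 1:]"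

lemma book_gamma_exact:
  "book_gamma m * [:0, 1:] = ([:0, 1:] - 1) ^ (m - 1) - (-1) ^ (m - 1)"
proof -
  have "poly (([:0, 1:] - 1) ^ (m - 1) - (-1) ^ (m - 1) :: int poly) 0 = 0"
    by simp
  then have "[:0, 1:] dvd (([:0, 1:] - 1) ^ (m - 1) - (-1) ^ (m - 1) :: int poly)"
    by (simp only: poly_eq_0_iff_dvd minus_zero)
  then show ?thesis
    unfolding book_gamma_def by (rule dvd_div_mult_self)
qed

end

theory Submission imports Defs begin

text \<open>Once the colors \<open>a \<noteq> b\<close> of \<open>u\<close> and \<open>v\<close> are chosen, the pages are colored independently,
  and a page is colored by a walk with \<open>m - 1\<close> steps in the complete graph on the colors. The
  number of such walks is \<open>\<gamma>\<^sub>m\<close> if the ends differ and \<open>\<gamma>\<^sub>m + (-1)\<^sup>m\<^sup>-\<^sup>1\<close> if they agree. On an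
  unsigned page the ends are \<open>a\<close> and \<open>b\<close>; on the page with the negative edge they are \<open>-a\<close> and
  \<open>b\<close>, which agree for exactly \<open>\<lambda> - 1\<close> of the \<open>\<lambda> (\<lambda> - 1)\<close> pairs (those with \<open>b = -a \<noteq> 0\<close>). Hence
  the sum over all pairs is \<open>\<gamma>\<^sub>m\<^sup>n\<^sup>-\<^sup>1 (\<lambda> - 1) (\<lambda> \<gamma>\<^sub>m + (-1)\<^sup>m\<^sup>-\<^sup>1) = \<gamma>\<^sub>m\<^sup>n\<^sup>-\<^sup>1 (\<lambda> - 1)\<^sup>m\<close>.\<close>

section \<open>Counting walks in the complete graph on a set of colors\<close>

text \<open>The parameter \<open>l\<close> counts steps, so a walk has \<open>l + 1\<close>
  positions. Extensionality beyond \<open>l\<close> makes each walk a single function, which keeps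
  the cardinality meaningful.\<close>

definition walks :: "'c set \<Rightarrow> nat \<Rightarrow> 'c \<Rightarrow> 'c \<Rightarrow> (nat \<Rightarrow> 'c) set" where
  "walks C l a b =
     {f \<in> {..l} \<rightarrow>\<^sub>E C. f 0 = a \<and> f l = b \<and> (\<forall>j<l. f j \<noteq> f (Suc j))}"

lemma finite_walks: "finite C \<Longrightarrow> finite (walks C l a b)"
  unfolding walks_def by (rule finite_Collect_conjI) (auto intro: finite_PiE)

lemma walks_0:
  assumes "a \<in> C"
  shows "walks C 0 a b = (if a = b then {\<lambda>j\<in>{..0}. a} else {})"
  using assms by (auto simp: walks_def PiE_iff extensional_def fun_eq_iff)

text \<open>Deleting the last position leaves a walk of \<open>l\<close> steps ending at some
  \<open>x\<close>; the final step only forces \<open>x\<close> to differ from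
  \<open>b\<close>.\<close>

lemma walks_Suc:
  assumes "b \<in> C"
  shows "walks C (Suc l) a b = (\<Union>x\<in>C - {b}. (\<lambda>f. f(Suc l := b)) ` walks C l a x)"
proof (intro equalityI subsetI)
  fix f assume f: "f \<in> walks C (Suc l) a b"
  let ?g = "restrict f {..l}"
  have "?g \<in> walks C l a (f l)"
    using f by (auto simp: walks_def PiE_iff)
  moreover have "f = ?g(Suc l := b)"
    using f by (auto simp: walks_def PiE_iff extensional_def fun_eq_iff restrict_def)
  moreover have "f l \<in> C - {b}"
    using f by (auto simp: walks_def PiE_iff)
  ultimately show "f \<in> (\<Union>x\<in>C - {b}. (\<lambda>f. f(Suc l := b)) ` walks C l a x)"
    by blast
next
  fix f assume "f \<in> (\<Union>x\<in>C - {b}. (\<lambda>f. f(Suc l := b)) ` walks C l a x)"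
  then show "f \<in> walks C (Suc l) a b"
    using assms by (auto simp: walks_def PiE_iff extensional_def less_Suc_eq)
qed

lemma card_walks_Suc:
  assumes "finite C" "b \<in> C"
  shows "card (walks C (Suc l) a b) = (\<Sum>x\<in>C - {b}. card (walks C l a x))"
proof -
  \<comment> \<open>Walks of \<open>l\<close> steps are all undefined at \<open>Suc l\<close>, so
    overwriting that value loses no information.\<close>
  have inj: "inj_on (\<lambda>f. f(Suc l := b)) (\<Union>x. walks C l a x)"
  proof (rule inj_onI)
    fix f g
    assume "f \<in> (\<Union>x. walks C l a x)" "g \<in> (\<Union>x. walks C l a x)"
      and eq: "f(Suc l := b) = g(Suc l := b)"
    then have "f (Suc l) = g (Suc l)"
      by (auto simp: walks_def PiE_iff extensional_def)
    with eq show "f = g"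
      by (metis fun_upd_triv fun_upd_upd)
  qed
  have disj: "walks C l a x \<inter> walks C l a y = {}" if "x \<noteq> y" for x y
    using that by (auto simp: walks_def)
  have "card (walks C (Suc l) a b)
      = card ((\<lambda>f. f(Suc l := b)) ` (\<Union>x\<in>C - {b}. walks C l a x))"
    by (simp add: walks_Suc[OF assms(2)] image_UN)
  also have "\<dots> = card (\<Union>x\<in>C - {b}. walks C l a x)"
    by (rule card_image, rule inj_on_subset[OF inj]) auto
  also have "\<dots> = (\<Sum>x\<in>C - {b}. card (walks C l a x))"
    by (rule card_UN_disjoint) (use assms in \<open>auto simp: finite_walks disj\<close>)
  finally show ?thesis .
qed

text \<open>With J the all-ones matrix and q the number of colors, this is an entry of q times the
  \<open>l\<close>-th power of the adjacency matrix J - I. Its eigenvalues are q - 1 on constant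
  vectors and -1 on vectors of sum zero. The factor q avoids a division.\<close>

lemma card_walks:
  assumes "finite C" "a \<in> C" "b \<in> C"
  shows "int (card C) * int (card (walks C l a b))
    = (int (card C) - 1) ^ l + (-1) ^ l * (if a = b then int (card C) - 1 else -1)"
  using assms(3)
proof (induction l arbitrary: b)
  case 0
  then show ?case
    using assms by (simp add: walks_0)
next
  case (Suc l)
  define q where "q = int (card C)"
  have cC: "int (card (C - {b})) = q - 1"
  proof -
    have "card C \<ge> 1"
      using assms by (metis One_nat_def Suc_leI card_gt_0_iff empty_iff)
    then show ?thesis
      using Suc.prems assms by (simp add: card_Diff_singleton q_def of_nat_diff)
  qed
  have "q * int (card (walks C (Suc l) a b))
      = (\<Sum>x\<in>C - {b}. (q - 1) ^ l + (-1) ^ l * (if a = x then q - 1 else -1))"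
    unfolding q_def using Suc assms(1)
    by (simp add: card_walks_Suc sum_distrib_left)
  \<comment> \<open>Writing \<open>q - 1\<close> as \<open>-1 + q\<close> leaves a summand constant
    in \<open>x\<close> plus a term supported at \<open>x = a\<close>, which survives exactly when
    \<open>a\<close> differs from \<open>b\<close>.\<close>
  also have "\<dots> = (\<Sum>x\<in>C - {b}. ((q - 1) ^ l - (-1) ^ l) + (if a = x then (-1) ^ l * q else 0))"
    by (intro sum.cong) (auto simp: algebra_simps)
  also have "\<dots> = (q - 1) * ((q - 1) ^ l - (-1) ^ l) + (if a \<in> C - {b} then (-1) ^ l * q else 0)"
    using assms(1) cC by (simp add: sum.distrib)
  also have "\<dots> = (q - 1) ^ Suc l + (-1) ^ Suc l * (if a = b then q - 1 else -1)"
    using assms(2) by (auto simp: algebra_simps)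
  finally show ?case
    by (simp add: q_def)
qed

section \<open>Colorings of the book as families of walks\<close>

text \<open>The negative edge \<open>u u\<^sub>1\<^sup>1\<close> acts as a positive edge from a vertex of color \<open>-c(u)\<close>, so
  page \<open>i\<close> starts at the color \<open>page_start i (c u)\<close>.\<close>

definition page_start :: "nat \<Rightarrow> int \<Rightarrow> int" where
  "page_start i a = (if i = 1 then - a else a)"

text \<open>Removing the edge uv from a cycle of length \<open>m\<close> leaves a path with
  \<open>m - 1\<close> edges. The walk reads the colors along it from u to v, and
  \<open>page_start\<close> at position 0 absorbs the sign.\<close>

definition page_walk :: "nat \<Rightarrow> (book_vertex \<Rightarrow> int) \<Rightarrow> nat \<Rightarrow> nat \<Rightarrow> int" where
  "page_walk m c i = (\<lambda>j\<in>{..m - 1}. if j = 0 then page_start i (c Spine_u)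
     else if j = m - 1 then c Spine_v else c (Page i j))"

text \<open>This inverts \<open>page_walk\<close>. The end values of each \<open>g i\<close> are not
  read, since \<open>a\<close> and \<open>b\<close> determine them; \<open>undefined\<close> off the
  book makes the coloring extensional.\<close>

definition glue_pages ::
    "nat \<Rightarrow> nat \<Rightarrow> int \<Rightarrow> int \<Rightarrow> (nat \<Rightarrow> nat \<Rightarrow> int) \<Rightarrow> book_vertex \<Rightarrow> int" where
  "glue_pages m n a b g x = (case x of Spine_u \<Rightarrow> a | Spine_v \<Rightarrow> b
     | Page i j \<Rightarrow> if 1 \<le> i \<and> i \<le> n \<and> 1 \<le> j \<and> j \<le> m - 2 then g i j else undefined)"

text \<open>The condition on an edge is symmetric in its ends for either sign, so each unordered
  edge yields one inequality. On the negative edge the sign moves into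
  \<open>page_start\<close>.\<close>

lemma proper_colorings_signed_book:
  assumes "m \<ge> 3"
  shows "c \<in> proper_colorings (signed_book m n) k \<longleftrightarrow>
    c \<in> verts (book m n) \<rightarrow>\<^sub>E {- int k..int k} \<and> c Spine_u \<noteq> c Spine_v \<and>
    (\<forall>i. 1 \<le> i \<and> i \<le> n \<longrightarrow> c (Page i 1) \<noteq> page_start i (c Spine_u) \<and>
       (\<forall>j. 1 \<le> j \<and> j + 1 \<le> m - 2 \<longrightarrow> c (Page i j) \<noteq> c (Page i (j + 1))) \<and>
       c (Page i (m - 2)) \<noteq> c Spine_v)"
    (is "?L \<longleftrightarrow> ?R")
proof
  assume ?L
  then have dom: "c \<in> verts (book m n) \<rightarrow>\<^sub>E {- int k..int k}"
    and ne: "\<And>x y. {x, y} \<in> edges (book m n) \<Longrightarrow>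
      c x \<noteq> (if {x, y} = {Spine_u, Page 1 1} then -1 else 1) * c y"
    by (auto simp: proper_colorings_def signed_book_def with_negative_edges_def)
  have "c Spine_u \<noteq> c Spine_v"
    using ne[of Spine_u Spine_v] by (auto simp: book_def doubleton_eq_iff)
  moreover have "c (Page i 1) \<noteq> page_start i (c Spine_u)" if "1 \<le> i" "i \<le> n" for i
    using ne[of "Page i 1" Spine_u] that
    by (auto simp: book_def doubleton_eq_iff page_start_def)
  moreover have "c (Page i j) \<noteq> c (Page i (j + 1))"
    if "1 \<le> i" "i \<le> n" "1 \<le> j" "j + 1 \<le> m - 2" for i j
  proof -
    have "{Page i j, Page i (j + 1)} \<in> edges (book m n)"
      using that unfolding book_def by fastforce
    from ne[OF this] show ?thesis
      by (simp add: doubleton_eq_iff)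
  qed
  moreover have "c (Page i (m - 2)) \<noteq> c Spine_v" if "1 \<le> i" "i \<le> n" for i
    using ne[of "Page i (m - 2)" Spine_v] that
    by (auto simp: book_def doubleton_eq_iff)
  ultimately show ?R
    using dom by blast
next
  assume R: ?R
  have "c x \<noteq> (if {x, y} = {Spine_u, Page 1 1} then -1 else 1) * c y"
    if "{x, y} \<in> edges (book m n)" for x y
  proof -
    from that consider
        "{x, y} = {Spine_u, Spine_v}"
      | i where "{x, y} = {Spine_u, Page i 1}" "1 \<le> i" "i \<le> n"
      | i j where "{x, y} = {Page i j, Page i (j + 1)}" "1 \<le> i" "i \<le> n" "1 \<le> j" "j + 1 \<le> m - 2"
      | i where "{x, y} = {Page i (m - 2), Spine_v}" "1 \<le> i" "i \<le> n"
      unfolding book_def by auto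
    then show ?thesis
    proof cases
      case 1
      then show ?thesis using R by (auto simp: doubleton_eq_iff)
    next
      case 2
      then have "c (Page i 1) \<noteq> page_start i (c Spine_u)" using R by blast
      with 2(1) show ?thesis
        by (auto simp: doubleton_eq_iff page_start_def split: if_splits)
    next
      case 3
      then have "c (Page i j) \<noteq> c (Page i (j + 1))" using R by blast
      with 3(1) show ?thesis by (auto simp: doubleton_eq_iff)
    next
      case 4
      then have "c (Page i (m - 2)) \<noteq> c Spine_v" using R by blast
      with 4(1) show ?thesis by (auto simp: doubleton_eq_iff)
    qed
  qed
  with R show ?L
    by (simp add: proper_colorings_def signed_book_def with_negative_edges_def)
qed

lemma page_walk_in_walks:
  assumes "m \<ge> 3" "c \<in> proper_colorings (signed_book m n) k" "1 \<le> i" "i \<le> n"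
  shows "page_walk m c i
    \<in> walks {- int k..int k} (m - 1) (page_start i (c Spine_u)) (c Spine_v)"
proof -
  note R = assms(2)[unfolded proper_colorings_signed_book[OF assms(1)]]
  have in_C: "c x \<in> {- int k..int k}" if "x \<in> verts (book m n)" for x
    using R that by (meson PiE_mem)
  have u: "c Spine_u \<in> {- int k..int k}" and v: "c Spine_v \<in> {- int k..int k}"
    using in_C by (simp_all add: book_def)
  have p: "c (Page i j) \<in> {- int k..int k}" if "1 \<le> j" "j \<le> m - 2" for j
    by (rule in_C) (use that assms in \<open>auto simp: book_def\<close>)
  have "page_walk m c i \<in> {..m - 1} \<rightarrow>\<^sub>E {- int k..int k}"
    unfolding page_walk_def
  proof (rule restrict_PiE_iff[THEN iffD2], intro ballI)
    fix j assume "j \<in> {..m - 1}"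
    \<comment> \<open>The color set is symmetric about 0, so the negated start is again a
      color.\<close>
    then show "(if j = 0 then page_start i (c Spine_u) else if j = m - 1 then c Spine_v
        else c (Page i j)) \<in> {- int k..int k}"
      using u v p[of j] by (simp add: page_start_def)
  qed
  moreover have "page_walk m c i j \<noteq> page_walk m c i (Suc j)" if j: "j < m - 1" for j
  proof -
    \<comment> \<open>These are the edge at u, the edges between inner vertices, and the edge at
      v.\<close>
    consider "j = 0" | "1 \<le> j" "j + 1 \<le> m - 2" | "1 \<le> j" "j = m - 2"
      using j by linarith
    then show ?thesis
    proof cases
      case 1
      moreover have "Suc 0 \<noteq> m - 1" "Suc 0 \<le> m - 1" using assms(1) by linarith+
      moreover have "c (Page i 1) \<noteq> page_start i (c Spine_u)" using R assms by blast
      ultimately show ?thesis by (auto simp: page_walk_def)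
    next
      case 2
      moreover have "c (Page i j) \<noteq> c (Page i (j + 1))" using 2 R assms by blast
      ultimately show ?thesis by (auto simp: page_walk_def)
    next
      case 3
      moreover have "Suc (m - 2) = m - 1" "m - 2 \<noteq> m - 1" using assms(1) by linarith+
      moreover have "c (Page i (m - 2)) \<noteq> c Spine_v" using R assms by blast
      ultimately show ?thesis by (auto simp: page_walk_def)
    qed
  qed
  moreover have "page_walk m c i 0 = page_start i (c Spine_u)"
    "page_walk m c i (m - 1) = c Spine_v"
    using assms(1) by (auto simp: page_walk_def)
  ultimately show ?thesis
    by (simp add: walks_def)
qed

text \<open>The \<open>m - 1\<close> steps of the walk \<open>g i\<close> are precisely the edges of
  page \<open>i\<close> other than uv, and uv itself is handled by
  \<open>a \<noteq> b\<close>.\<close>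

lemma glue_pages_proper:
  assumes m: "m \<ge> 3" and ab: "a \<in> {- int k..int k}" "b \<in> {- int k..int k}" "a \<noteq> b"
    and g: "\<And>i. 1 \<le> i \<Longrightarrow> i \<le> n \<Longrightarrow> g i \<in> walks {- int k..int k} (m - 1) (page_start i a) b"
  shows "glue_pages m n a b g \<in> proper_colorings (signed_book m n) k"
proof -
  have gC: "g i j \<in> {- int k..int k}" if "1 \<le> i" "i \<le> n" "j \<le> m - 2" for i j
    using g[OF that(1,2)] that(3) PiE_mem[of "g i" "{..m - 1}" _ j] by (auto simp: walks_def)
  have step: "g i j \<noteq> g i (Suc j)" if "1 \<le> i" "i \<le> n" "j < m - 1" for i j
    using g[OF that(1,2)] that(3) by (simp add: walks_def)
  have ends: "g i 0 = page_start i a" "g i (m - 1) = b" if "1 \<le> i" "i \<le> n" for i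
    using g[OF that] by (simp_all add: walks_def)
  have "glue_pages m n a b g \<in> verts (book m n) \<rightarrow>\<^sub>E {- int k..int k}"
  proof (rule PiE_I)
    fix x assume "x \<in> verts (book m n)"
    then show "glue_pages m n a b g x \<in> {- int k..int k}"
      using ab gC by (auto simp: book_def glue_pages_def)
  next
    fix x assume "x \<notin> verts (book m n)"
    then show "glue_pages m n a b g x = undefined"
      by (cases x) (auto simp: book_def glue_pages_def)
  qed
  moreover have "g i 1 \<noteq> page_start i a" if "1 \<le> i" "i \<le> n" for i
    using step[OF that, of 0] ends[OF that] m by simp
  moreover have "g i (m - 2) \<noteq> b" if "1 \<le> i" "i \<le> n" for i
  proof -
    have "Suc (m - 2) = m - 1" using m by linarith
    then show ?thesis using step[OF that, of "m - 2"] ends[OF that] m by simp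
  qed
  moreover have "1 \<le> m - 2" using m by linarith
  ultimately show ?thesis
    unfolding proper_colorings_signed_book[OF m]
    using ab(3) step by (auto simp: glue_pages_def)
qed

text \<open>Every edge except uv lies on exactly one page. Fixing distinct colors of u and v
  therefore splits the remaining conditions into independent ones, one walk per page.\<close>

lemma bij_betw_proper_colorings:
  assumes m: "m \<ge> 3"
  shows "bij_betw (\<lambda>((a, b), g). glue_pages m n a b g)
    (SIGMA (a, b) : (SIGMA a : {- int k..int k}. {- int k..int k} - {a}).
       \<Pi>\<^sub>E i\<in>{1..n}. walks {- int k..int k} (m - 1) (page_start i a) b)
    (proper_colorings (signed_book m n) k)"
    (is "bij_betw ?F ?S ?P")
proof (rule bij_betw_byWitness[where
      f' = "\<lambda>c. ((c Spine_u, c Spine_v), \<lambda>i\<in>{1..n}. page_walk m c i)"])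
  let ?G = "\<lambda>c. ((c Spine_u, c Spine_v), \<lambda>i\<in>{1..n}. page_walk m c i)"
  show "\<forall>s\<in>?S. ?G (?F s) = s"
  proof
    fix s assume "s \<in> ?S"
    then obtain a b g where s: "s = ((a, b), g)"
      and g: "g \<in> (\<Pi>\<^sub>E i\<in>{1..n}. walks {- int k..int k} (m - 1) (page_start i a) b)"
      by auto
    have "page_walk m (glue_pages m n a b g) i = g i" if i: "i \<in> {1..n}" for i
    proof
      fix j
      have "g i \<in> walks {- int k..int k} (m - 1) (page_start i a) b"
        using g i by (rule PiE_mem)
      \<comment> \<open>The positions that \<open>glue_pages\<close> does not read are recovered
        from the fixed ends and, beyond \<open>m - 1\<close>, from extensionality.\<close>
      then have "g i 0 = page_start i a" "g i (m - 1) = b" "j > m - 1 \<Longrightarrow> g i j = undefined"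
        by (auto simp: walks_def PiE_iff extensional_def)
      moreover have "j > m - 1 \<or> j = 0 \<or> j = m - 1 \<or> 1 \<le> j \<and> j \<le> m - 2 \<and> j < m - 1"
        by linarith
      ultimately show "page_walk m (glue_pages m n a b g) i j = g i j"
        using i by (auto simp: page_walk_def glue_pages_def)
    qed
    then have "(\<lambda>i\<in>{1..n}. page_walk m (glue_pages m n a b g) i) = g"
      using g by (auto simp: fun_eq_iff PiE_iff extensional_def restrict_def)
    then show "?G (?F s) = s"
      by (simp add: s glue_pages_def)
  qed
  show "\<forall>c\<in>?P. ?F (?G c) = c"
  proof
    fix c assume c: "c \<in> ?P"
    have "glue_pages m n (c Spine_u) (c Spine_v) (\<lambda>i\<in>{1..n}. page_walk m c i) x = c x" for x
    proof (cases x)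
      case (Page i j)
      show ?thesis
      proof (cases "1 \<le> i \<and> i \<le> n \<and> 1 \<le> j \<and> j \<le> m - 2")
        case True
        then have "j \<noteq> 0" "j < m - 1" by linarith+
        with True Page show ?thesis by (simp add: glue_pages_def page_walk_def)
      next
        case False
        with Page have "x \<notin> verts (book m n)" by (auto simp: book_def)
        moreover have "c \<in> verts (book m n) \<rightarrow>\<^sub>E {- int k..int k}"
          using c proper_colorings_signed_book[OF m] by blast
        ultimately have "c x = undefined"
          by (meson PiE_arb)
        with False Page show ?thesis by (auto simp: glue_pages_def)
      qed
    qed (simp_all add: glue_pages_def)
    then show "?F (?G c) = c" by auto
  qed
  show "?F ` ?S \<subseteq> ?P"
  proof (rule image_subsetI)
    fix s assume "s \<in> ?S"
    then obtain a b g where s: "s = ((a, b), g)"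
      and ab: "a \<in> {- int k..int k}" "b \<in> {- int k..int k}" "b \<noteq> a"
      and g: "g \<in> (\<Pi>\<^sub>E i\<in>{1..n}. walks {- int k..int k} (m - 1) (page_start i a) b)"
      by force
    have "glue_pages m n a b g \<in> ?P"
      by (rule glue_pages_proper[OF m ab(1,2) ab(3)[symmetric]]) (rule PiE_mem[OF g], simp)
    then show "?F s \<in> ?P"
      by (simp add: s)
  qed
  show "?G ` ?P \<subseteq> ?S"
  proof (rule image_subsetI)
    fix c assume c: "c \<in> ?P"
    then have "c Spine_u \<noteq> c Spine_v" "c \<in> verts (book m n) \<rightarrow>\<^sub>E {- int k..int k}"
      using proper_colorings_signed_book[OF m] by blast+
    moreover have "Spine_u \<in> verts (book m n)" "Spine_v \<in> verts (book m n)"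
      by (simp_all add: book_def)
    ultimately have "(c Spine_u, c Spine_v) \<in> (SIGMA a : {- int k..int k}. {- int k..int k} - {a})"
      by (auto dest: PiE_mem)
    moreover have "(\<lambda>i\<in>{1..n}. page_walk m c i)
        \<in> (\<Pi>\<^sub>E i\<in>{1..n}. walks {- int k..int k} (m - 1) (page_start i (c Spine_u)) (c Spine_v))"
      using page_walk_in_walks[OF m c] by (subst restrict_PiE_iff) simp
    ultimately show "?G c \<in> ?S"
      by blast
  qed
qed

section \<open>Summation over the colors of the spine\<close>

theorem theorem3p7:
  fixes m n :: nat
  assumes "m \<ge> 3" and "n \<ge> 1"
  shows "chromatic_poly (signed_book m n) = ([:0, 1:] - 1) ^ m * book_gamma m ^ (n - 1)"
proof (rule chromatic_poly_eqI)
  fix k :: nat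
  define C where "C = {- int k..int k}"
  define q where "q = 2 * int k + 1"
  define l where "l = m - 1"
  define G where "G = poly (book_gamma m) q"
  let ?W = "\<lambda>i a b. walks C l (page_start i a) b"
  have q: "int (card C) = q" "q \<noteq> 0" and C: "finite C" "0 \<in> C"
    by (simp_all add: C_def q_def)
  have neg: "- a \<in> C" if "a \<in> C" for a
    using that by (simp add: C_def)
  have "poly (book_gamma m * [:0, 1:]) q = (q - 1) ^ l - (-1) ^ l"
    unfolding book_gamma_exact by (simp add: l_def)
  then have qG: "q * G = (q - 1) ^ l - (-1) ^ l"
    by (simp add: G_def mult.commute)
  have walks: "int (card (walks C l a b)) = G + (if a = b then (-1) ^ l else 0)"
    if "a \<in> C" "b \<in> C" for a b
  proof -
    \<comment> \<open>Both sides are compared after multiplication by \<open>q\<close>, which is odd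
      and hence can be cancelled.\<close>
    have "q * int (card (walks C l a b)) = q * (G + (if a = b then (-1) ^ l else 0))"
      using card_walks[OF C(1) that, of l] qG q by (simp add: algebra_simps)
    with q(2) show ?thesis by simp
  qed
  have pages: "(\<Prod>i\<in>{1..n}. int (card (?W i a b)))
      = G ^ (n - 1) * (G + (if b = - a then (-1) ^ l else 0))"
    if "a \<in> C" "b \<in> C - {a}" for a b
  proof -
    \<comment> \<open>Page 1 exists because \<open>n \<ge> 1\<close>. It is split off since the ends
      of every other page are \<open>a\<close> and \<open>b\<close>, which differ.\<close>
    have "{1..n} = insert 1 {2..n}" using assms(2) by auto
    then have "(\<Prod>i\<in>{1..n}. int (card (?W i a b)))
        = int (card (?W 1 a b)) * (\<Prod>i\<in>{2..n}. int (card (?W i a b)))"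
      by simp
    also have "(\<Prod>i\<in>{2..n}. int (card (?W i a b))) = (\<Prod>i\<in>{2..n}. G)"
      using that by (intro prod.cong) (auto simp: page_start_def walks)
    finally show ?thesis
      using that neg by (auto simp: page_start_def walks)
  qed
  have inner: "(\<Sum>b\<in>C - {a}. G + (if b = - a then (-1) ^ l else 0))
      = (q - 1) * G + (if a = 0 then 0 else (-1) ^ l)" if a: "a \<in> C" for a
  proof -
    have "int (card (C - {a})) = q - 1"
      using a C q by (simp add: card_Diff_singleton of_nat_diff q_def)
    \<comment> \<open>The choice \<open>b = - a\<close> is excluded only when it coincides with
      \<open>a\<close>, that is, at 0.\<close>
    moreover have "- a \<in> C - {a} \<longleftrightarrow> a \<noteq> 0"
      using neg[OF a] by auto
    ultimately show ?thesis
      using C(1) by (simp add: sum.distrib)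
  qed
  have "int (card (proper_colorings (signed_book m n) k))
      = int (card (SIGMA (a, b) : (SIGMA a : C. C - {a}). \<Pi>\<^sub>E i\<in>{1..n}. ?W i a b))"
    using bij_betw_same_card[OF bij_betw_proper_colorings[OF assms(1), of n k]]
    by (simp add: C_def l_def)
  also have "\<dots> = (\<Sum>(a, b)\<in>(SIGMA a : C. C - {a}). \<Prod>i\<in>{1..n}. int (card (?W i a b)))"
    using C(1)
    by (subst card_SigmaI) (auto simp: card_PiE finite_PiE finite_walks intro!: sum.cong)
  also have "\<dots> = (\<Sum>a\<in>C. \<Sum>b\<in>C - {a}. \<Prod>i\<in>{1..n}. int (card (?W i a b)))"
    using C(1) by (subst sum.Sigma) auto
  also have "\<dots> = (\<Sum>a\<in>C. G ^ (n - 1) * ((q - 1) * G + (if a = 0 then 0 else (-1) ^ l)))"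
    by (intro sum.cong refl) (simp only: pages sum_distrib_left[symmetric] inner cong: sum.cong)
  \<comment> \<open>The exceptional color 0 becomes a correction, so that the main term is constant
    in \<open>a\<close>.\<close>
  also have "\<dots> = (\<Sum>a\<in>C. G ^ (n - 1) * ((q - 1) * G + (-1) ^ l)
      - (if a = 0 then G ^ (n - 1) * (-1) ^ l else 0))"
    by (intro sum.cong) (auto simp: algebra_simps)
  also have "\<dots> = q * (G ^ (n - 1) * ((q - 1) * G + (-1) ^ l)) - G ^ (n - 1) * (-1) ^ l"
    using C q by (simp add: sum_subtractf)
  also have "\<dots> = G ^ (n - 1) * ((q - 1) * (q * G + (-1) ^ l))"
    by (simp add: algebra_simps)
  \<comment> \<open>By \<open>qG\<close>, the factor \<open>q * G + (-1) ^ l\<close> collapses to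
    \<open>(q - 1) ^ l\<close>.\<close>
  also have "\<dots> = (q - 1) ^ Suc l * G ^ (n - 1)"
    by (simp add: qG)
  also have "Suc l = m"
    using assms(1) by (simp add: l_def)
  finally show "poly (([:0, 1:] - 1) ^ m * book_gamma m ^ (n - 1)) (2 * int k + 1)
      = int (card (proper_colorings (signed_book m n) k))"
    by (simp add: G_def q_def)
qed

end
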